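(* For every finite tree $T$, there exists a subdivision $T'$ of $T$ such that $h(T')\le 2$.
   Context: A subdivision of a tree is obtained by replacing edges with paths. Hunters and Rabbit game on a graph $G=(V,E)$. A hunter strategy is a finite sequence $(S_1,\dots,S_\ell)$ of non-empty subsets of $V$, using $\max_i|S_i|$ hunters. A rabbit trajectory is a walk $(r_0,\dots,r_\ell)$ in $G$ ($r_i\in N(r_{i-1})$); the strategy is winning if every rabbit trajectory has some $j<\ell$ with $r_j\in S_{j+1}$. The hunter number $h(G)$ is the minimum number of hunters of a winning hunter strategy ($0$ for a single vertex). *)

theory Defs
  imports "Graph_Theory.Graph_Theory"
begin

text \<open>
  Undirected graphs are symmetric loop-free digraphs without parallel arcs
  (\<^locale>\<open>pair_graph\<close>, which includes finiteness). The library predicate named tree, meant for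
  oriented graphs, cannot be used for these: on a symmetric digraph it counts the closed walk
  $u, v, u$ as a cycle. Undirected cycles are the directed cycles of length at least 3.
\<close>

definition finite_tree :: "'a pair_pre_digraph \<Rightarrow> bool" where
  "finite_tree T \<longleftrightarrow> pair_graph T \<and> connected (with_proj T) \<and>
     \<not> (\<exists>p. pre_digraph.cycle (with_proj T) p \<and> 3 \<le> length p)"

text \<open>
  The library relation \<^const>\<open>subdivision\<close> (iterated replacement of an edge by a path of length
  two) keeps the original vertices. Passing to an isomorphic copy first lets the subdivision live
  on another vertex type, so that new vertices are always available.
\<close>

definition is_subdivision_of :: "'b pair_pre_digraph \<Rightarrow> 'a pair_pre_digraph \<Rightarrow> bool" where
  "is_subdivision_of H G \<longleftrightarrow>
     (\<exists>G'. digraph_iso (with_proj G) (with_proj G') \<and> subdivision_pair G' H)"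

definition hunter_strategy :: "('a, 'b) pre_digraph \<Rightarrow> 'a set list \<Rightarrow> bool" where
  "hunter_strategy G S \<longleftrightarrow> S \<noteq> [] \<and> (\<forall>X \<in> set S. X \<noteq> {} \<and> X \<subseteq> verts G)"

definition num_hunters :: "'a set list \<Rightarrow> nat" where
  "num_hunters S = Max (card ` set S)"

definition rabbit_trajectory :: "('a, 'b) pre_digraph \<Rightarrow> nat \<Rightarrow> 'a list \<Rightarrow> bool" where
  "rabbit_trajectory G l r \<longleftrightarrow> vwalk r G \<and> length r = Suc l"

text \<open>Lists are indexed from 0, so the shot $S_{j+1}$ is the list entry with index $j$.\<close>

definition winning_strategy :: "('a, 'b) pre_digraph \<Rightarrow> 'a set list \<Rightarrow> bool" where
  "winning_strategy G S \<longleftrightarrow> hunter_strategy G S \<and>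
     (\<forall>r. rabbit_trajectory G (length S) r \<longrightarrow> (\<exists>j < length S. r ! j \<in> S ! j))"

definition hunter_number :: "('a, 'b) pre_digraph \<Rightarrow> nat" where
  "hunter_number G =
     (if card (verts G) = 1 then 0
      else (LEAST k. \<exists>S. winning_strategy G S \<and> num_hunters S = k))"

text \<open>The minimum is over a non-empty set, since shooting at all vertices at once wins.\<close>

lemma winning_strategy_exists:
  assumes "verts G \<noteq> {}"
  shows "winning_strategy G [verts G]"
proof -
  have "r ! 0 \<in> verts G" if "vwalk r G" for r
    using that by (auto simp: vwalk_def)
  then show ?thesis
    using assms by (auto simp: winning_strategy_def hunter_strategy_def rabbit_trajectory_def)
qed

end

theory Submission
  imports Defs
begin

text \<open>
  A tree with root $a$ arises by joining a tree $A$ with root $a$ to a disjoint tree $B$ by an edge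
  from $a$ to the root $b$ of $B$. Suppose that subdivisions of $A$ and $B$ can each be cleared by
  two hunters even if the rabbit is allowed to enter through the root. Replace the edge by a path of
  even length, the stem, that is longer than the time needed to clear $A$. Clear $B$ and sweep the
  stem from $b$ to $a$; then clear $A$, ignoring the stem. Meanwhile the rabbit may
  recontaminate the stem, but it has no time to reach $b$, so that finally one hunter guards $a$
  while the other one sweeps the contaminated part of the stem back towards $a$. All this treats a
  rabbit in one class of the bipartition; repeating the strategy after an odd number of steps
  catches a rabbit in the other class.
\<close>

section \<open>Rooted trees\<close>

text \<open>Cutting an edge at the root, rather than removing a leaf, splits the tree into two
  rooted trees; the edge that is cut is the one later replaced by a stem.\<close>

inductive rtree :: "'a pair_pre_digraph \<Rightarrow> 'a \<Rightarrow> bool" where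
  single: "rtree \<lparr>pverts = {a}, parcs = {}\<rparr> a"
| join: "\<lbrakk>rtree A a; rtree B b; pverts A \<inter> pverts B = {}\<rbrakk> \<Longrightarrow>
    rtree \<lparr>pverts = pverts A \<union> pverts B, parcs = parcs A \<union> parcs B \<union> {(a, b), (b, a)}\<rparr> a"

lemma rtree_root_in_verts: "rtree G a \<Longrightarrow> a \<in> pverts G"
  by (induction rule: rtree.induct) auto

lemma rtree_finite_verts: "rtree G a \<Longrightarrow> finite (pverts G)"
  by (induction rule: rtree.induct) auto

lemma rtree_arcs_subset: "rtree G a \<Longrightarrow> parcs G \<subseteq> pverts G \<times> pverts G"
  by (induction rule: rtree.induct) (auto dest: rtree_root_in_verts)

lemma rtree_sym_arcs: "rtree G a \<Longrightarrow> sym (parcs G)"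
  by (induction rule: rtree.induct) (auto simp: sym_def)

lemma rtree_irrefl: "rtree G a \<Longrightarrow> (x, x) \<notin> parcs G"
  by (induction rule: rtree.induct) (auto dest: rtree_root_in_verts)

lemma pair_bidirected_digraphI:
  assumes "parcs G \<subseteq> pverts G \<times> pverts G" "sym (parcs G)" "\<And>x. (x, x) \<notin> parcs G"
  shows "pair_bidirected_digraph G"
  using assms by unfold_locales (auto simp: symmetric_def)

lemma rtree_bidirected: "rtree G a \<Longrightarrow> pair_bidirected_digraph G"
  by (intro pair_bidirected_digraphI rtree_arcs_subset rtree_sym_arcs rtree_irrefl)

lemma rtree_connected:
  assumes "rtree G a" "x \<in> pverts G" "y \<in> pverts G"
  shows "(x, y) \<in> (parcs G)\<^sup>*"
proof -
  have "(a, x) \<in> (parcs G)\<^sup>*" if "rtree G a" "x \<in> pverts G" for G :: "'a pair_pre_digraph" and a x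
    using that
  proof (induction rule: rtree.induct)
    case (join A a B b)
    let ?R = "parcs A \<union> parcs B \<union> {(a, b), (b, a)}"
    from join.prems consider "x \<in> pverts A" | "x \<in> pverts B" by auto
    then show ?case
    proof cases
      case 1
      then have "(a, x) \<in> (parcs A)\<^sup>*" using join by auto
      then have "(a, x) \<in> ?R\<^sup>*" by (rule rtrancl_mono[THEN subsetD, rotated]) auto
      then show ?thesis by simp
    next
      case 2
      then have "(b, x) \<in> (parcs B)\<^sup>*" using join by auto
      then have "(b, x) \<in> ?R\<^sup>*" by (rule rtrancl_mono[THEN subsetD, rotated]) auto
      moreover have "(a, b) \<in> ?R" by simp
      ultimately have "(a, x) \<in> ?R\<^sup>*" by (meson converse_rtrancl_into_rtrancl)
      then show ?thesis by simp
    qed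
  qed auto
  then have "(a, x) \<in> (parcs G)\<^sup>*" "(a, y) \<in> (parcs G)\<^sup>*" using assms by auto
  then show ?thesis
    using rtree_sym_arcs[OF assms(1)] by (meson rtrancl_trans sym_rtrancl symD)
qed

text \<open>The leaf is added inside the part that contains \<open>x\<close>, so both roots stay
  where they are and the other part is untouched.\<close>

lemma rtree_add_leaf:
  assumes "rtree G a" "x \<in> pverts G" "y \<notin> pverts G"
  shows "rtree \<lparr>pverts = insert y (pverts G), parcs = parcs G \<union> {(x, y), (y, x)}\<rparr> a"
  using assms
proof (induction rule: rtree.induct)
  case (single a)
  then show ?case using join[OF rtree.single[of a] rtree.single[of y]] by (auto simp: insert_commute)
next
  case (join A a B b)
  from join.prems consider "x \<in> pverts A" | "x \<in> pverts B" by auto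
  then show ?case
  proof cases
    case 1
    then have "rtree \<lparr>pverts = insert y (pverts A), parcs = parcs A \<union> {(x, y), (y, x)}\<rparr> a"
      using join by auto
    from rtree.join[OF this join.hyps(2)] show ?thesis
      using join by (auto simp: ac_simps insert_commute)
  next
    case 2
    then have "rtree \<lparr>pverts = insert y (pverts B), parcs = parcs B \<union> {(x, y), (y, x)}\<rparr> b"
      using join by auto
    from rtree.join[OF join.hyps(1) this] show ?thesis
      using join by (auto simp: ac_simps insert_commute)
  qed
qed

text \<open>A largest subgraph of \<open>T\<close> that is an \<open>rtree\<close> with root
  \<open>a\<close> is all of \<open>T\<close>. By connectedness it is spanning, since otherwise a
  leaf could be added, and a missing arc would close a cycle with a path inside the
  subgraph.\<close>

lemma finite_tree_rtree:
  assumes "finite_tree T" "a \<in> pverts T"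
  shows "rtree T a"
proof -
  interpret T: pair_graph T using assms(1) by (simp add: finite_tree_def)
  define P where "P k \<longleftrightarrow> (\<exists>G. rtree G a \<and> pverts G \<subseteq> pverts T \<and> parcs G \<subseteq> parcs T \<and> card (pverts G) = k)" for k
  have "P 1" unfolding P_def using single[of a] assms(2) by (intro exI) (rule conjI, assumption, auto)
  moreover have "k \<le> card (pverts T)" if "P k" for k
    using that unfolding P_def by (auto intro: card_mono)
  ultimately obtain k where k: "P k" "\<And>j. P j \<Longrightarrow> j \<le> k"
    using Nat.nat_le_linear by (metis Nat.ex_has_greatest_nat)
  then obtain G where G: "rtree G a" "pverts G \<subseteq> pverts T" "parcs G \<subseteq> parcs T" "card (pverts G) = k"
    by (auto simp: P_def)
  have sub: "y \<in> pverts G" if "(a, y) \<in> (parcs T)\<^sup>*" for y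
    using that
  proof induction
    case (step y z)
    show ?case
    proof (rule ccontr)
      assume z: "z \<notin> pverts G"
      let ?G = "\<lparr>pverts = insert z (pverts G), parcs = parcs G \<union> {(y, z), (z, y)}\<rparr>"
      have "rtree ?G a" using rtree_add_leaf[OF G(1) step.IH z] .
      moreover have "card (pverts ?G) = Suc k"
        using z G(4) rtree_finite_verts[OF G(1)] by simp
      moreover have "pverts ?G \<subseteq> pverts T" "parcs ?G \<subseteq> parcs T"
        using G step by (auto dest: T.wellformed' T.arcs_symmetric)
      ultimately have "P (Suc k)" unfolding P_def by blast
      then show False using k(2) by fastforce
    qed
  qed (use rtree_root_in_verts G in auto)
  have verts: "pverts G = pverts T"
  proof
    show "pverts T \<subseteq> pverts G"
    proof
      fix y assume y: "y \<in> pverts T"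
      have "strongly_connected (with_proj T)"
        using assms(1) T.symmetric_connected_imp_strongly_connected T.sym_arcs
        by (auto simp: finite_tree_def)
      then have "a \<rightarrow>\<^sup>*\<^bsub>with_proj T\<^esub> y" using y assms(2) by (auto simp: strongly_connected_def)
      then show "y \<in> pverts G" using sub by (auto dest: reachable_rtranclI)
    qed
  qed (rule G)
  interpret G: pair_bidirected_digraph G by (rule rtree_bidirected[OF G(1)])
  have "parcs T \<subseteq> parcs G"
  proof (rule ccontr)
    assume "\<not> parcs T \<subseteq> parcs G"
    then obtain u v where uv: "(u, v) \<in> parcs T" "(u, v) \<notin> parcs G" by auto
    then have in_G: "u \<in> pverts G" "v \<in> pverts G" using T.wellformed' verts by auto
    then have "v \<rightarrow>\<^sup>*\<^bsub>with_proj G\<^esub> u"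
      using rtree_connected[OF G(1)] by (simp add: G.reachable_conv)
    then obtain p where p: "G.apath v p u" using G.reachable_apath by blast
    have "T.awalk v p u"
      using p G(2,3) unfolding G.apath_def G.awalk_def T.awalk_def by auto
    then have "T.awalk u ((u, v) # p) u" using uv by (simp add: T.awalk_Cons_iff)
    moreover have "distinct (tl (pawalk_verts u ((u, v) # p)))"
      using p by (simp add: G.apath_def)
    ultimately have "T.cycle ((u, v) # p)" by (auto simp: T.cycle_def)
    \<comment> \<open>Only cycles of length at least 3 are excluded. If \<open>p\<close> were empty,
      \<open>(u, v)\<close> would be a loop; if \<open>p\<close> were a single arc, the reverse of
      \<open>(u, v)\<close> and hence by symmetry \<open>(u, v)\<close> itself would belong to
      \<open>G\<close>.\<close>
    moreover have "2 \<le> length p"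
    proof (rule ccontr)
      assume "\<not> 2 \<le> length p"
      then consider "p = []" | e where "p = [e]" by (cases p rule: list_exhaust_NSC) auto
      then show False
      proof cases
        case 1
        then have "u = v" using p by (auto simp: G.apath_def G.awalk_def)
        then show False using uv T.no_loops' by blast
      next
        case 2
        then have "(v, u) \<in> parcs G" using p by (auto simp: G.apath_def G.awalk_def)
        then show False using uv G.arcs_symmetric by blast
      qed
    qed
    ultimately show False using assms(1) by (force simp: finite_tree_def)
  qed
  then have "G = T" using verts G(3) by (intro pair_pre_digraph.equality) auto
  then show ?thesis using G(1) by simp
qed

text \<open>Serves to move the tree to the naturals, where fresh vertices never run out.\<close>

lemma rtree_image:
  assumes "rtree G a" "inj_on f (pverts G)"
  shows "rtree \<lparr>pverts = f ` pverts G, parcs = map_prod f f ` parcs G\<rparr> (f a)"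
  using assms
proof (induction rule: rtree.induct)
  case (single a)
  then show ?case using rtree.single[of "f a"] by simp
next
  case (join A a B b)
  then have "inj_on f (pverts A)" "inj_on f (pverts B)" "f ` pverts A \<inter> f ` pverts B = {}"
    by (auto simp: inj_on_Un)
  then show ?case
    using rtree.join[OF join.IH(1,2)] by (simp add: image_Un insert_commute)
qed

section \<open>Clearing a rooted graph\<close>

text \<open>\<open>C t\<close> bounds the possible positions of the rabbit at time \<open>t\<close>. The root \<open>a\<close> belongs to it at
  all even times, whether or not it was reached inside \<open>G\<close>, since \<open>G\<close> will be a part of a larger
  graph from which the rabbit may enter through \<open>a\<close>.\<close>

definition hunt_phase :: "'a pair_pre_digraph \<Rightarrow> 'a \<Rightarrow> nat \<Rightarrow> 'a set \<Rightarrow> 'a set \<Rightarrow> bool" where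
  "hunt_phase G a n Z Z' \<longleftrightarrow> even n \<and> (\<exists>S C. C 0 = Z \<and> C n = Z' \<and>
     (\<forall>t<n. S t \<noteq> {} \<and> S t \<subseteq> pverts G \<and> card (S t) \<le> 2 \<and> parcs G `` (C t - S t) \<subseteq> C (Suc t)) \<and>
     (\<forall>t\<le>n. C t \<subseteq> pverts G \<and> (a \<in> C t \<longleftrightarrow> even t)))"

lemma hunt_phaseI:
  assumes "even n" "C 0 = Z" "C n = Z'"
    and "\<And>t. t < n \<Longrightarrow> S t \<noteq> {} \<and> S t \<subseteq> pverts G \<and> card (S t) \<le> 2"
    and "\<And>t u v. \<lbrakk>t < n; u \<in> C t; u \<notin> S t; (u, v) \<in> parcs G\<rbrakk> \<Longrightarrow> v \<in> C (Suc t)"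
    and "\<And>t. t \<le> n \<Longrightarrow> C t \<subseteq> pverts G" "\<And>t. t \<le> n \<Longrightarrow> a \<in> C t \<longleftrightarrow> even t"
  shows "hunt_phase G a n Z Z'"
  unfolding hunt_phase_def using assms by (intro conjI exI[of _ S] exI[of _ C]) auto

lemma hunt_phaseE:
  assumes "hunt_phase G a n Z Z'"
  obtains C S where "even n" "C 0 = Z" "C n = Z'"
    and "\<And>t. t < n \<Longrightarrow> S t \<noteq> {} \<and> S t \<subseteq> pverts G \<and> card (S t) \<le> 2"
    and "\<And>t u v. \<lbrakk>t < n; u \<in> C t; u \<notin> S t; (u, v) \<in> parcs G\<rbrakk> \<Longrightarrow> v \<in> C (Suc t)"
    and "\<And>t. t \<le> n \<Longrightarrow> C t \<subseteq> pverts G" "\<And>t. t \<le> n \<Longrightarrow> a \<in> C t \<longleftrightarrow> even t"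
proof -
  from assms obtain S C where *: "even n" "C 0 = Z" "C n = Z'"
     "\<forall>t<n. S t \<noteq> {} \<and> S t \<subseteq> pverts G \<and> card (S t) \<le> 2 \<and> parcs G `` (C t - S t) \<subseteq> C (Suc t)"
     "\<forall>t\<le>n. C t \<subseteq> pverts G \<and> (a \<in> C t \<longleftrightarrow> even t)"
    unfolding hunt_phase_def by auto
  show thesis by (rule that[of C S]) (use * in auto)
qed

lemma hunt_phase_trans:
  assumes "hunt_phase G a n Z Z'" "hunt_phase G a m Z' Z''"
  shows "hunt_phase G a (n + m) Z Z''"
proof -
  from assms(1) obtain C S where C: "even n" "C 0 = Z" "C n = Z'"
    "\<And>t. t < n \<Longrightarrow> S t \<noteq> {} \<and> S t \<subseteq> pverts G \<and> card (S t) \<le> 2"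
    "\<And>t u v. \<lbrakk>t < n; u \<in> C t; u \<notin> S t; (u, v) \<in> parcs G\<rbrakk> \<Longrightarrow> v \<in> C (Suc t)"
    "\<And>t. t \<le> n \<Longrightarrow> C t \<subseteq> pverts G" "\<And>t. t \<le> n \<Longrightarrow> a \<in> C t \<longleftrightarrow> even t"
    by (rule hunt_phaseE) blast
  from assms(2) obtain D R where D: "even m" "D 0 = Z'" "D m = Z''"
    "\<And>t. t < m \<Longrightarrow> R t \<noteq> {} \<and> R t \<subseteq> pverts G \<and> card (R t) \<le> 2"
    "\<And>t u v. \<lbrakk>t < m; u \<in> D t; u \<notin> R t; (u, v) \<in> parcs G\<rbrakk> \<Longrightarrow> v \<in> D (Suc t)"
    "\<And>t. t \<le> m \<Longrightarrow> D t \<subseteq> pverts G" "\<And>t. t \<le> m \<Longrightarrow> a \<in> D t \<longleftrightarrow> even t"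
    by (rule hunt_phaseE) blast
  show ?thesis
  proof (rule hunt_phaseI[where S = "\<lambda>t. if t < n then S t else R (t - n)"
        and C = "\<lambda>t. if t \<le> n then C t else D (t - n)"], goal_cases)
    case (5 t u v)
    show ?case
    proof (cases "t < n")
      case True
      then show ?thesis using 5 C(5)[of t u v] by auto
    next
      case False
      \<comment> \<open>At \<open>t = n\<close> the combined bound is still \<open>C n\<close>,
        which equals \<open>D 0\<close> because the two phases meet in \<open>Z'\<close>.\<close>
      have "u \<in> D (t - n)" using 5(2) False C(3) D(2) by (auto split: if_splits)
      then show ?thesis using 5 False D(5)[of "t - n" u v] by (auto simp: Suc_diff_le)
    qed
  next
    case (7 t)
    then show ?case using C(1,7) D(7)[of "t - n"] by auto
  next
    case (6 t)
    then show ?case using C(6) D(6)[of "t - n"] by auto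
  qed (use C(1-4) D(1-4) in auto)
qed

definition bipartition :: "'a pair_pre_digraph \<Rightarrow> 'a set \<Rightarrow> bool" where
  "bipartition G X \<longleftrightarrow> X \<subseteq> pverts G \<and> (\<forall>(u, v) \<in> parcs G. u \<in> X \<longleftrightarrow> v \<notin> X)"

text \<open>The root counts as contaminated at every even time, so \<open>{a}\<close> is the least
  set with which a phase can end. For the same reason \<open>X\<close> is the class that contains
  \<open>a\<close>.\<close>

definition clearable :: "'a pair_pre_digraph \<Rightarrow> 'a \<Rightarrow> bool" where
  "clearable G a \<longleftrightarrow> (\<exists>X n. bipartition G X \<and> hunt_phase G a n X {a})"

section \<open>Joining two rooted graphs by a stem\<close>

text \<open>The root of \<open>B\<close> is \<open>p 0\<close>, and \<open>p 1\<close>, ...,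
  \<open>p m\<close> are the inner vertices of the path from it to \<open>a\<close>. For
  \<open>m = 0\<close> the two graphs are joined by a single edge, from which the subdivision
  starts.\<close>

definition stem :: "'a pair_pre_digraph \<Rightarrow> 'a \<Rightarrow> 'a pair_pre_digraph \<Rightarrow> (nat \<Rightarrow> 'a) \<Rightarrow> nat \<Rightarrow> 'a pair_pre_digraph" where
  "stem A a B p m = \<lparr>pverts = pverts A \<union> pverts B \<union> p ` {..m},
     parcs = parcs A \<union> parcs B \<union> (\<Union>i<m. {(p i, p (Suc i)), (p (Suc i), p i)}) \<union> {(a, p m), (p m, a)}\<rparr>"

text \<open>The path from \<open>p 0\<close> to \<open>a\<close> has \<open>m + 1\<close> edges. As
  \<open>m\<close> is odd, both roots lie in the same class, so the even times of a phase of
  \<open>A\<close> and of a phase of \<open>B\<close> agree with those of the whole graph.\<close>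

locale stem_graph =
  fixes A :: "'a pair_pre_digraph" and a and B and p :: "nat \<Rightarrow> 'a" and m and XA XB
  assumes wf_A: "parcs A \<subseteq> pverts A \<times> pverts A" and wf_B: "parcs B \<subseteq> pverts B \<times> pverts B"
    and a: "a \<in> pverts A" "a \<in> XA" and b: "p 0 \<in> pverts B" "p 0 \<in> XB"
    and disj: "pverts A \<inter> pverts B = {}"
    and inj: "inj_on p {..m}" and fresh: "\<And>i. \<lbrakk>0 < i; i \<le> m\<rbrakk> \<Longrightarrow> p i \<notin> pverts A \<union> pverts B"
    and odd: "odd m"
    and XA: "bipartition A XA" and XB: "bipartition B XB"
begin

abbreviation "H \<equiv> stem A a B p m"

definition "X = XA \<union> XB \<union> p ` {i. i \<le> m \<and> even i}"

text \<open>The vertices at which a rabbit that starts in \<open>X\<close> can be at time \<open>t\<close>.\<close>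

definition "cls t = (if even (t::nat) then X else pverts H - X)"

lemma p_notin_A: "i \<le> m \<Longrightarrow> p i \<notin> pverts A"
  using fresh[of i] b disj by (cases "i = 0") auto

lemma p_in_B_iff: "i \<le> m \<Longrightarrow> p i \<in> pverts B \<longleftrightarrow> i = 0"
  using fresh[of i] b by (cases "i = 0") auto

lemma p_eq_iff: "\<lbrakk>i \<le> m; j \<le> m\<rbrakk> \<Longrightarrow> p i = p j \<longleftrightarrow> i = j"
  using inj by (auto simp: inj_on_def)

lemma pverts_H: "pverts H = pverts A \<union> pverts B \<union> p ` {..m}"
  by (simp add: stem_def)

lemma p_in_X_iff: "i \<le> m \<Longrightarrow> p i \<in> X \<longleftrightarrow> even i"
  using p_notin_A[of i] p_in_B_iff[of i] XA XB b inj_on_image_mem_iff[OF inj, of i "{i. i \<le> m \<and> even i}"]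
  unfolding X_def bipartition_def by auto

lemma in_X_A: "v \<in> pverts A \<Longrightarrow> v \<in> X \<longleftrightarrow> v \<in> XA"
  using p_notin_A disj XB by (auto simp: X_def bipartition_def)

lemma in_X_B: "v \<in> pverts B \<Longrightarrow> v \<in> X \<longleftrightarrow> v \<in> XB"
  using p_in_B_iff disj XA b by (auto simp: X_def bipartition_def)

lemma arc_cases [consumes 1, case_names A B up down last_a a_last]:
  assumes "(u, v) \<in> parcs H"
  obtains "(u, v) \<in> parcs A" "u \<in> pverts A" "v \<in> pverts A"
  | "(u, v) \<in> parcs B" "u \<in> pverts B" "v \<in> pverts B"
  | i where "i < m" "u = p i" "v = p (Suc i)"
  | i where "i < m" "u = p (Suc i)" "v = p i"
  | "u = p m" "v = a"
  | "u = a" "v = p m"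
  using assms wf_A wf_B unfolding stem_def by auto

lemma bipartition_H: "bipartition H X"
proof -
  have "u \<in> X \<longleftrightarrow> v \<notin> X" if "(u, v) \<in> parcs H" for u v
    using that
  proof (cases rule: arc_cases)
    case A
    then show ?thesis using XA in_X_A by (auto simp: bipartition_def)
  next
    case B
    then show ?thesis using XB in_X_B by (auto simp: bipartition_def)
  qed (use in_X_A p_in_X_iff odd a in auto)
  moreover have "X \<subseteq> pverts H"
    using XA XB by (auto simp: X_def pverts_H bipartition_def)
  ultimately show ?thesis by (auto simp: bipartition_def)
qed

lemma wf_H: "(u, v) \<in> parcs H \<Longrightarrow> v \<in> pverts H"
  by (cases rule: arc_cases) (auto simp: pverts_H a)

lemma cls_Suc: "\<lbrakk>(u, v) \<in> parcs H; u \<in> cls t\<rbrakk> \<Longrightarrow> v \<in> cls (Suc t)"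
  using bipartition_H wf_H[of u v] by (auto simp: cls_def bipartition_def)

lemma cls_subset: "cls t \<subseteq> pverts H"
  using bipartition_H by (auto simp: cls_def bipartition_def)

lemma a_in_cls: "a \<in> cls t \<longleftrightarrow> even t"
  using a in_X_A by (auto simp: cls_def pverts_H)

lemma p_in_cls: "i \<le> m \<Longrightarrow> p i \<in> cls t \<longleftrightarrow> (even i \<longleftrightarrow> even t)"
  using p_in_X_iff by (auto simp: cls_def pverts_H)

text \<open>The stem and \<open>A\<close> stay contaminated while \<open>B\<close> is cleared; they recontaminate the root of
  \<open>B\<close> only at even times, when a phase of \<open>B\<close> counts that root as contaminated anyway.\<close>

lemma phase_clear_B:
  assumes "hunt_phase B (p 0) n XB {p 0}"
  shows "hunt_phase H a n X (X - (pverts B - {p 0}))"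
proof -
  from assms obtain C S where C: "even n" "C 0 = XB" "C n = {p 0}"
    "\<And>t. t < n \<Longrightarrow> S t \<noteq> {} \<and> S t \<subseteq> pverts B \<and> card (S t) \<le> 2"
    "\<And>t u v. \<lbrakk>t < n; u \<in> C t; u \<notin> S t; (u, v) \<in> parcs B\<rbrakk> \<Longrightarrow> v \<in> C (Suc t)"
    "\<And>t. t \<le> n \<Longrightarrow> C t \<subseteq> pverts B" "\<And>t. t \<le> n \<Longrightarrow> p 0 \<in> C t \<longleftrightarrow> even t"
    by (rule hunt_phaseE) blast
  show ?thesis
  proof (rule hunt_phaseI[where S = S and C = "\<lambda>t. C t \<union> (cls t - pverts B)"], goal_cases)
    case 2
    then show ?case using C(2) XB in_X_B by (auto simp: cls_def bipartition_def)
  next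
    case 3
    then show ?case using C(1,3) p_in_X_iff[of 0] by (auto simp: cls_def)
  next
    case (5 t u v)
    from 5(4) show ?case
    proof (cases rule: arc_cases)
      case B
      then show ?thesis using C(5) 5 by auto
    next
      case (up i)
      have "u \<in> cls t" using 5(2) up p_in_cls p_in_B_iff C(6,7)[of t] 5(1) by (cases "i = 0") auto
      then show ?thesis using cls_Suc[OF 5(4)] up p_in_B_iff by auto
    next
      case (down i)
      have "u \<in> cls t" using 5(1,2) down p_in_B_iff C(6)[of t] by auto
      then have "v \<in> cls (Suc t)" using cls_Suc[OF 5(4)] by auto
      then show ?thesis using down p_in_B_iff p_in_cls C(7)[of "Suc t"] 5(1) by (cases "i = 0") auto
    next
      case A
      then have "u \<in> cls t" using 5(1,2) disj C(6)[of t] by auto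
      then show ?thesis using cls_Suc[OF 5(4)] A disj by auto
    next
      case last_a
      have "m \<noteq> 0" using odd by (cases m) auto
      then have "u \<in> cls t" using 5(1,2) last_a p_in_B_iff C(6)[of t] by auto
      then show ?thesis using cls_Suc[OF 5(4)] last_a a disj by auto
    next
      case a_last
      have "m \<noteq> 0" using odd by (cases m) auto
      have "u \<in> cls t" using 5(1,2) a_last a disj C(6)[of t] by auto
      then show ?thesis using cls_Suc[OF 5(4)] a_last p_in_B_iff \<open>m \<noteq> 0\<close> by auto
    qed
  next
    case (6 t)
    then show ?case using C(6) cls_subset by (fastforce simp: pverts_H)
  next
    case (7 t)
    then show ?case using C(6)[of t] a disj a_in_cls by auto
  next
    case (4 t)
    then show ?case using C(4)[of t] by (auto simp: pverts_H)
  qed (use C in auto)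
qed

text \<open>The hunter at \<open>p t\<close> advances one vertex per step towards \<open>a\<close>.
  By parity, a rabbit ahead on the stem is at distance at least 2 and cannot slip past.
  \<open>A\<close> is left fully contaminated, hence the final set \<open>XA\<close>.\<close>

lemma phase_sweep_stem:
  "hunt_phase H a (Suc m) (X - (pverts B - {p 0})) XA"
proof (rule hunt_phaseI[where S = "\<lambda>t. {p t}" and C = "\<lambda>t. cls t \<inter> (pverts A \<union> p ` {t..m})"], goal_cases)
  case 2
  show ?case using bipartition_H disj b p_in_B_iff
    by (auto simp: cls_def bipartition_def pverts_H)
next
  case 3
  show ?case using odd in_X_A XA by (auto simp: cls_def bipartition_def)
next
  case (5 t u v)
  have v: "v \<in> cls (Suc t)" using cls_Suc 5 by auto
  have p_later: "Suc t \<le> i" if "u = p i" "i \<le> m" for i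
    using 5 that p_notin_A p_eq_iff by (cases "i = t") auto
  from 5(4) show ?case
  proof (cases rule: arc_cases)
    case B
    then have "u = p 0" using 5 disj p_in_B_iff by auto
    then show ?thesis using p_later[of 0] by auto
  next
    case (up i)
    then show ?thesis using v p_later[of i] by auto
  next
    case (down i)
    then have "Suc t \<le> Suc i" "even (Suc i) = even t" using p_later[of "Suc i"] 5(2) p_in_cls[of "Suc i" t] by auto
    then have "Suc t \<le> i" by (metis Suc_leI Suc_le_mono even_Suc le_neq_implies_less)
    then show ?thesis using v down by auto
  next
    case a_last
    \<comment> \<open>At the last shot, \<open>t = m\<close>, the time is odd and the rabbit is not
      at \<open>a\<close>, so it cannot re-enter the swept stem.\<close>
    have "even t" using 5(2) a_last a_in_cls by auto
    then have "Suc t \<le> m" using odd 5(1) by (metis Suc_leI le_neq_implies_less less_Suc_eq_le)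
    then show ?thesis using v a_last by auto
  qed (use v a in auto)
next
  case (6 t)
  then show ?case using cls_subset by auto
next
  case (7 t)
  then show ?case using a_in_cls a by auto
qed (use odd in \<open>auto simp: pverts_H\<close>)

text \<open>At time \<open>t\<close> a rabbit that left \<open>A\<close> through \<open>a\<close>
  has reached at most the last \<open>t\<close> vertices of the stem. If it returns, it enters
  \<open>a\<close> at an even time, when \<open>a\<close> counts as contaminated anyway.\<close>

lemma phase_clear_A:
  assumes "hunt_phase A a n XA {a}" "n \<le> m"
  shows "hunt_phase H a n XA (X \<inter> ({a} \<union> p ` {Suc m - n..m}))"
proof -
  from assms(1) obtain C S where C: "even n" "C 0 = XA" "C n = {a}"
    "\<And>t. t < n \<Longrightarrow> S t \<noteq> {} \<and> S t \<subseteq> pverts A \<and> card (S t) \<le> 2"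
    "\<And>t u v. \<lbrakk>t < n; u \<in> C t; u \<notin> S t; (u, v) \<in> parcs A\<rbrakk> \<Longrightarrow> v \<in> C (Suc t)"
    "\<And>t. t \<le> n \<Longrightarrow> C t \<subseteq> pverts A" "\<And>t. t \<le> n \<Longrightarrow> a \<in> C t \<longleftrightarrow> even t"
    by (rule hunt_phaseE) blast
  show ?thesis
  proof (rule hunt_phaseI[where S = S and C = "\<lambda>t. C t \<union> (cls t \<inter> p ` {Suc m - t..m})"], goal_cases)
    case 2
    then show ?case using C(2) by auto
  next
    case 3
    then show ?case using C(1,3) a in_X_A by (auto simp: cls_def)
  next
    case (5 t u v)
    have near: "u \<in> cls t \<and> Suc m - t \<le> i" if "u = p i" "i \<le> m" for i
      using 5(1,2) that p_notin_A[of i] C(6)[of t] by (auto simp: p_eq_iff)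
    from 5(4) show ?case
    proof (cases rule: arc_cases)
      case A
      then have "u \<in> C t" using 5(2) p_notin_A by auto
      then show ?thesis using C(5) 5 A by auto
    next
      case B
      \<comment> \<open>The vertex \<open>p 0\<close> is out of reach: since \<open>t < n\<close>
        and \<open>n\<close> is at most \<open>m\<close>, the contaminated end of the stem starts at
        a positive index.\<close>
      then have "u = p 0" using 5(1,2) C(6)[of t] disj p_in_B_iff by auto
      then show ?thesis using near[of 0] 5(1) assms(2) by auto
    next
      case (up i)
      then show ?thesis using near[of i] cls_Suc[OF 5(4)] by auto
    next
      case (down i)
      then show ?thesis using near[of "Suc i"] cls_Suc[OF 5(4)] by auto
    next
      case last_a
      then have "even (Suc t)" using near[of m] cls_Suc[OF 5(4)] a_in_cls by auto
      then show ?thesis using C(7)[of "Suc t"] last_a 5(1) by auto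
    next
      case a_last
      have "a \<in> C t" using 5(2) a_last p_notin_A a by auto
      then have "even t" using C(7)[of t] 5(1) by auto
      then show ?thesis using a_last p_in_cls[of m "Suc t"] odd 5(1) by auto
    qed
  next
    case (6 t)
    then show ?case using C(6) cls_subset by (fastforce simp: pverts_H)
  next
    case (7 t)
    then show ?case using C(7)[of t] a p_notin_A by auto
  next
    case (4 t)
    then show ?case using C(4)[of t] by (auto simp: pverts_H)
  qed (use C in auto)
qed

text \<open>One hunter blocks \<open>a\<close> throughout while the other sweeps from
  \<open>p (Suc m - n)\<close>, the far end of the contaminated part, towards \<open>a\<close>. This
  index is even, so hunter and rabbit again agree in parity and the rabbit cannot slip past. After
  \<open>n\<close> shots the stem is used up.\<close>

lemma phase_sweep_back:
  assumes "n \<le> m" "even n"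
  shows "hunt_phase H a n (X \<inter> ({a} \<union> p ` {Suc m - n..m})) {a}"
proof (rule hunt_phaseI[where S = "\<lambda>t. {a, p (Suc m - n + t)}"
      and C = "\<lambda>t. cls t \<inter> ({a} \<union> p ` {Suc m - n + t..m})"], goal_cases)
  case 2
  then show ?case by (auto simp: cls_def)
next
  case 3
  then show ?case using assms a in_X_A by (auto simp: cls_def)
next
  case (5 t u v)
  have v: "v \<in> cls (Suc t)" using cls_Suc 5 by auto
  \<comment> \<open>Having escaped both shots, the rabbit is on the stem, strictly ahead of the
    sweeping hunter.\<close>
  obtain i where i: "u = p i" "Suc m - n + t < i" "i \<le> m"
    using 5(2,3) by (force simp: order_le_less)
  have parity: "even i \<longleftrightarrow> even t" using 5(2) i p_in_cls by auto
  from 5(4) show ?case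
  proof (cases rule: arc_cases)
    case A
    then show ?thesis using i p_notin_A by auto
  next
    case B
    then show ?thesis using i p_in_B_iff by auto
  next
    case (up j)
    then have "j = i" using i p_eq_iff[of i j] by auto
    then show ?thesis using up i v by auto
  next
    case (down j)
    then have j: "i = Suc j" using i p_eq_iff[of i "Suc j"] by auto
    have "even (Suc m - n)" using assms odd by auto
    then have "j \<noteq> Suc m - n + t" using parity j by auto
    then show ?thesis using down i v j by auto
  next
    case last_a
    then show ?thesis using v by auto
  next
    case a_last
    then show ?thesis using i p_notin_A a by auto
  qed
next
  case (6 t)
  then show ?case using cls_subset by auto
next
  case (7 t)
  then show ?case using a_in_cls by auto
next
  case (4 t)
  then have "p (Suc m - n + t) \<in> p ` {..m}" using assms by (intro imageI) auto
  then show ?case using a by (auto simp: pverts_H card_insert_if)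
qed (use assms in auto)

text \<open>The four phases take \<open>nB\<close>, \<open>m + 1\<close>, \<open>nA\<close> and
  \<open>nA\<close> steps; each starts with the set in which the previous one ends.\<close>

lemma clearable_stem:
  assumes "hunt_phase A a nA XA {a}" "hunt_phase B (p 0) nB XB {p 0}" "nA \<le> m"
  shows "clearable H a"
proof -
  have "even nA" using assms(1) by (simp add: hunt_phase_def)
  with assms show ?thesis unfolding clearable_def
    using bipartition_H phase_clear_B phase_sweep_stem phase_clear_A phase_sweep_back
    by (meson hunt_phase_trans)
qed

end

section \<open>Subdivisions\<close>

lemma subdivision_pair_bidirected:
  assumes "subdivision_pair G H"
  shows "pair_bidirected_digraph H"
  using assms by (rule bidirected_digraphI_subdivision)

lemma subdivision_pair_verts:
  assumes "subdivision_pair G H" shows "pverts G \<subseteq> pverts H"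
  using subdivision_verts_subset[OF assms] by auto

text \<open>Each division inside \<open>A\<close> is repeated in the larger graph: the new vertices
  avoid \<open>V\<close>, and no arc of \<open>K\<close> has both ends in \<open>A'\<close>, so
  dividing an arc never removes one from \<open>K\<close>.\<close>

lemma subdivision_pair_extend:
  assumes "subdivision_pair A A'"
    and "pair_bidirected_digraph \<lparr>pverts = pverts A \<union> V, parcs = parcs A \<union> K\<rparr>"
    and "pverts A' \<inter> V = {}" and "K \<inter> pverts A' \<times> pverts A' = {}"
  shows "subdivision_pair \<lparr>pverts = pverts A \<union> V, parcs = parcs A \<union> K\<rparr>
    \<lparr>pverts = pverts A' \<union> V, parcs = parcs A' \<union> K\<rparr>"
  using assms
proof (induction rule: subdivision_pair_induct)
  case base
  then show ?case using subdivision_pair_base[of "\<lparr>pverts = pverts A \<union> V, parcs = parcs A \<union> K\<rparr>"] by simp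
next
  case (divide e w I)
  interpret I: pair_bidirected_digraph I using divide.hyps(3) by (rule subdivision_pair_bidirected)
  obtain u v where e: "e = (u, v)" by (cases e)
  have uv: "u \<in> pverts I" "v \<in> pverts I" using divide.hyps e I.wellformed' by auto
  let ?I = "\<lparr>pverts = pverts I \<union> V, parcs = parcs I \<union> K\<rparr>"
  have *: "subdivision_pair \<lparr>pverts = pverts A \<union> V, parcs = parcs A \<union> K\<rparr> ?I"
    using divide by auto
  have "subdivide ?I e w = \<lparr>pverts = pverts (subdivide I e w) \<union> V, parcs = parcs (subdivide I e w) \<union> K\<rparr>"
    using uv divide.prems e by (intro pair_pre_digraph.equality) auto
  moreover have "subdivision_pair \<lparr>pverts = pverts A \<union> V, parcs = parcs A \<union> K\<rparr> (subdivide ?I e w)"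
    using divide * by (intro subdivision_pair_divide) auto
  ultimately show ?case by simp
qed

text \<open>The edge between \<open>a\<close> and the latest vertex \<open>p m\<close> is divided by
  \<open>p (Suc m)\<close>, so the path grows at its end next to \<open>a\<close>.\<close>

lemma subdivision_pair_stem:
  assumes "pair_bidirected_digraph (stem A a B p 0)"
    and "parcs A \<subseteq> pverts A \<times> pverts A" "parcs B \<subseteq> pverts B \<times> pverts B"
    and "a \<in> pverts A" "p 0 \<in> pverts B" "pverts A \<inter> pverts B = {}"
    and "inj_on p {..m}" and "\<And>i. \<lbrakk>0 < i; i \<le> m\<rbrakk> \<Longrightarrow> p i \<notin> pverts A \<union> pverts B"
  shows "subdivision_pair (stem A a B p 0) (stem A a B p m)"
  using assms(7,8)
proof (induction m)
  case 0
  then show ?case using assms by (simp add: subdivision_pair_base)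
next
  case (Suc m)
  have p_in_B: "p i \<in> pverts B \<longleftrightarrow> i = 0" if "i \<le> Suc m" for i
    using that Suc.prems(2)[of i] assms(5) by (cases "i = 0") auto
  have p_in_A: "p i \<notin> pverts A" if "i \<le> Suc m" for i
    using that Suc.prems(2)[of i] assms(5,6) by (cases "i = 0") auto
  have p_inj: "p i = p j \<longleftrightarrow> i = j" if "i \<le> Suc m" "j \<le> Suc m" for i j
    using that Suc.prems(1) by (auto simp: inj_on_def)
  have IH: "subdivision_pair (stem A a B p 0) (stem A a B p m)"
    by (rule Suc.IH[OF inj_on_subset[OF Suc.prems(1)] Suc.prems(2)]) auto
  have fresh: "p (Suc m) \<notin> pverts (stem A a B p m)"
    using p_in_B[of "Suc m"] p_in_A[of "Suc m"]
      inj_on_image_mem_iff[OF Suc.prems(1), of "Suc m" "{..m}"] by (auto simp: stem_def)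
  have "(a, p m) \<notin> parcs A" "(p m, a) \<notin> parcs A" "(a, p m) \<notin> parcs B" "(p m, a) \<notin> parcs B"
    using assms p_in_A[of m] by auto
  moreover have ends: "p i \<noteq> a" "a \<noteq> p i" if "i \<le> Suc m" for i using p_in_A[OF that] assms(4) by auto
  ultimately have "subdivide (stem A a B p m) (a, p m) (p (Suc m)) = stem A a B p (Suc m)"
    by (intro pair_pre_digraph.equality)
      (auto simp: stem_def atMost_Suc lessThan_Suc p_inj ends)
  moreover have "(a, p m) \<in> parcs (stem A a B p m)" by (simp add: stem_def)
  ultimately show ?case using subdivision_pair_divide[OF _ fresh IH] by metis
qed

lemma subdivision_pair_finite:
  assumes "subdivision_pair G H" "finite (pverts G)"
  shows "finite (pverts H)"
  using assms by (induction rule: subdivision_pair_induct) auto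

text \<open>The forbidden set \<open>F\<close> strengthens the induction: it keeps the new vertices
  of one part away from the other part.\<close>

lemma rtree_clearable_subdivision:
  fixes G :: "nat pair_pre_digraph"
  assumes "rtree G a" "finite F" "pverts G \<inter> F = {}"
  shows "\<exists>G'. subdivision_pair G G' \<and> clearable G' a \<and> pverts G' \<inter> F = {}"
  using assms
proof (induction arbitrary: F rule: rtree.induct)
  case (single a)
  let ?G = "\<lparr>pverts = {a}, parcs = {}\<rparr>"
  have "subdivision_pair ?G ?G"
    using rtree_bidirected[OF rtree.single] by (rule subdivision_pair_base)
  moreover have "hunt_phase ?G a 0 {a} {a}" by (rule hunt_phaseI[where C = "\<lambda>_. {a}"]) auto
  then have "clearable ?G a" unfolding clearable_def
    by (intro exI[of _ "{a}"] exI[of _ 0]) (auto simp: bipartition_def)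
  ultimately show ?case using single by blast
next
  case (join A a B b)
  let ?G = "\<lparr>pverts = pverts A \<union> pverts B, parcs = parcs A \<union> parcs B \<union> {(a, b), (b, a)}\<rparr>"
  have fin: "finite (pverts A)" "finite (pverts B)" using join.hyps(1,2)[THEN rtree_finite_verts] by auto
  \<comment> \<open>\<open>A'\<close> has to avoid the still undivided \<open>B\<close>; afterwards
    \<open>B'\<close> has to avoid \<open>A'\<close> together with its new vertices.\<close>
  obtain A' where A': "subdivision_pair A A'" "clearable A' a" "pverts A' \<inter> (F \<union> pverts B) = {}"
    using join.IH(1)[of "F \<union> pverts B"] join.hyps join.prems fin by auto
  have finA': "finite (pverts A')" using subdivision_pair_finite[OF A'(1)] fin by simp
  obtain B' where B': "subdivision_pair B B'" "clearable B' b" "pverts B' \<inter> (F \<union> pverts A') = {}"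
    using join.IH(2)[of "F \<union> pverts A'"] join.prems A' finA' by (auto simp: Int_Un_distrib Int_commute)
  have finB': "finite (pverts B')" using subdivision_pair_finite[OF B'(1)] fin by simp
  interpret A': pair_bidirected_digraph A' using A'(1) by (rule subdivision_pair_bidirected)
  interpret B': pair_bidirected_digraph B' using B'(1) by (rule subdivision_pair_bidirected)
  have wf: "parcs A' \<subseteq> pverts A' \<times> pverts A'" "parcs B' \<subseteq> pverts B' \<times> pverts B'"
    using A'.wellformed' B'.wellformed' by auto
  have wfB: "parcs B \<subseteq> pverts B \<times> pverts B" using join.hyps(2) by (rule rtree_arcs_subset)
  have a: "a \<in> pverts A" "a \<in> pverts A'" and b: "b \<in> pverts B" "b \<in> pverts B'"
    using join.hyps(1,2)[THEN rtree_root_in_verts] subdivision_pair_verts[OF A'(1)] subdivision_pair_verts[OF B'(1)]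
    by auto
  \<comment> \<open>The parts are subdivided one after the other: first \<open>A\<close> with
    \<open>B\<close> as the fixed remainder, then \<open>B\<close> with \<open>A'\<close> as the
    fixed remainder.\<close>
  let ?AB = "\<lparr>pverts = pverts A' \<union> pverts B, parcs = parcs A' \<union> (parcs B \<union> {(a, b), (b, a)})\<rparr>"
  have "subdivision_pair \<lparr>pverts = pverts A \<union> pverts B, parcs = parcs A \<union> (parcs B \<union> {(a, b), (b, a)})\<rparr> ?AB"
    using A' wfB b rtree_bidirected[OF rtree.join[OF join.hyps]]
    by (intro subdivision_pair_extend) (auto simp: Un_assoc)
  then have sd1: "subdivision_pair ?G ?AB" by (simp add: Un_assoc)
  have "pair_bidirected_digraph ?AB" using sd1 by (rule subdivision_pair_bidirected)
  then have "subdivision_pair \<lparr>pverts = pverts B \<union> pverts A', parcs = parcs B \<union> (parcs A' \<union> {(a, b), (b, a)})\<rparr>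
     \<lparr>pverts = pverts B' \<union> pverts A', parcs = parcs B' \<union> (parcs A' \<union> {(a, b), (b, a)})\<rparr>"
    using B' wf a by (intro subdivision_pair_extend) (auto simp: ac_simps)
  \<comment> \<open>A stem with \<open>m = 0\<close> looks only at \<open>p 0\<close>, so a constant
    path suffices here.\<close>
  then have sd2: "subdivision_pair ?AB (stem A' a B' (\<lambda>_. b) 0)"
    using b by (simp add: stem_def ac_simps insert_absorb)
  obtain XA nA XB nB where hunt: "bipartition A' XA" "hunt_phase A' a nA XA {a}"
      "bipartition B' XB" "hunt_phase B' b nB XB {b}"
    using A'(2) B'(2) unfolding clearable_def by auto
  have even_nA: "even nA" using hunt by (auto simp: hunt_phase_def)
  obtain q :: "nat \<Rightarrow> nat" where q: "inj q" "range q \<subseteq> - (F \<union> pverts A' \<union> pverts B')"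
    using infinite_countable_subset[of "- (F \<union> pverts A' \<union> pverts B')"] join.prems finA' finB'
    by (metis finite_Un finite_compl infinite_UNIV_nat)
  define p where "p i = (if i = 0 then b else q i)" for i
  have "b \<noteq> q i" "q i \<noteq> b" for i using subsetD[OF q(2) rangeI[of q i]] b by auto
  then have inj_p: "inj_on p S" for S
    using q(1) by (auto simp: p_def inj_on_def)
  have p_fresh: "p i \<notin> F \<union> pverts A' \<union> pverts B'" if "0 < i" for i
    using that subsetD[OF q(2) rangeI[of q i]] by (auto simp: p_def)
  have stem0: "stem A' a B' (\<lambda>_. b) 0 = stem A' a B' p 0" by (simp add: stem_def p_def)
  \<comment> \<open>\<open>Suc nA\<close> is odd because \<open>nA\<close> is even, and it satisfies
    the bound that \<open>phase_clear_A\<close> needs to keep the rabbit away from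
    \<open>b\<close>.\<close>
  let ?H = "stem A' a B' p (Suc nA)"
  have disj: "pverts A' \<inter> pverts B' = {}" using B'(3) by auto
  have sd3: "subdivision_pair (stem A' a B' p 0) ?H"
    using subdivision_pair_bidirected[OF sd2] wf a b p_fresh inj_p disj
    by (intro subdivision_pair_stem) (auto simp: stem0, auto simp: p_def)
  \<comment> \<open>Time 0 is even, so each phase starts with its root contaminated.\<close>
  have a_XA: "a \<in> XA" "b \<in> XB" using hunt by (auto simp: hunt_phase_def)
  interpret stem_graph A' a B' p "Suc nA" XA XB
    by unfold_locales (use wf a b a_XA disj inj_p p_fresh even_nA hunt in \<open>auto simp: p_def\<close>)
  have "clearable ?H a"
    using clearable_stem[of nA nB] hunt by (simp add: p_def)
  moreover have "subdivision_pair ?G ?H"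
    using sd1 sd2 sd3 unfolding stem0 by (blast intro: subdivision_trans)
  moreover have "pverts ?H \<inter> F = {}"
  proof -
    have "p i \<notin> F" for i using p_fresh[of i] b B'(3) by (cases "i = 0") (auto simp: p_def)
    then show ?thesis using A'(3) B'(3) by (auto simp: stem_def)
  qed
  ultimately show ?case by blast
qed

section \<open>From clearings to winning strategies\<close>

lemma vwalk_nth:
  "\<lbrakk>vwalk r G; Suc i < length r\<rbrakk> \<Longrightarrow> (r ! i, r ! Suc i) \<in> arcs_ends G"
proof (induction r arbitrary: i rule: vwalk_arcs.induct)
  case (3 x y xs)
  then show ?case by (cases i) (auto simp: vwalk_def)
qed (auto simp: vwalk_def)

text \<open>After the clearing, one more shot at \<open>a\<close> catches every rabbit that started
  in \<open>X\<close>. That makes \<open>n + 1\<close> shots, an odd number, so a rabbit that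
  started outside \<open>X\<close> is in \<open>X\<close> when the same shots are repeated.\<close>

lemma clearable_hunter_number:
  assumes "clearable G a"
  shows "hunter_number (with_proj G) \<le> 2"
proof -
  obtain X n where X: "bipartition G X" and "hunt_phase G a n X {a}"
    using assms by (auto simp: clearable_def)
  from this(2) obtain C S where C: "even n" "C 0 = X" "C n = {a}"
    "\<And>t. t < n \<Longrightarrow> S t \<noteq> {} \<and> S t \<subseteq> pverts G \<and> card (S t) \<le> 2"
    "\<And>t u v. \<lbrakk>t < n; u \<in> C t; u \<notin> S t; (u, v) \<in> parcs G\<rbrakk> \<Longrightarrow> v \<in> C (Suc t)"
    "\<And>t. t \<le> n \<Longrightarrow> C t \<subseteq> pverts G" "\<And>t. t \<le> n \<Longrightarrow> a \<in> C t \<longleftrightarrow> even t"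
    by (rule hunt_phaseE) blast
  define xs where "xs = map S [0..<n] @ [{a}]"
  have len: "length xs = Suc n" by (simp add: xs_def)
  have nth_xs: "t < n \<Longrightarrow> xs ! t = S t" "xs ! n = {a}" for t
    by (auto simp: xs_def nth_append)
  \<comment> \<open>The offset \<open>k\<close> covers both runs: it is 0 for the first and
    \<open>Suc n\<close> for the second.\<close>
  have caught: "\<exists>t\<le>n. r (k + t) \<in> xs ! t"
    if "r k \<in> X" and step: "\<And>t. t < n \<Longrightarrow> (r (k + t), r (Suc (k + t))) \<in> parcs G" for r k
  proof (rule ccontr)
    assume free: "\<not> (\<exists>t\<le>n. r (k + t) \<in> xs ! t)"
    have "r (k + t) \<in> C t" if "t \<le> n" for t
      using that
    proof (induction t)
      case (Suc t)
      then show ?case using C(5)[of t] step[of t] free nth_xs(1)[of t] by (metis Suc_leD Suc_le_lessD add_Suc_right)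
    qed (use \<open>r k \<in> X\<close> C in auto)
    then show False using C(3) free nth_xs(2) by blast
  qed
  have a: "a \<in> pverts G" using C(3,6) by blast
  have xs_ok: "Y \<noteq> {} \<and> Y \<subseteq> pverts G \<and> card Y \<le> 2" if "Y \<in> set xs" for Y
    using that C(4) a unfolding xs_def by (fastforce simp: card_insert_if)
  have "\<exists>j<length (xs @ xs). r ! j \<in> (xs @ xs) ! j"
    if r: "rabbit_trajectory (with_proj G) (length (xs @ xs)) r" for r
  proof -
    have step: "(r ! t, r ! Suc t) \<in> parcs G" if "t < Suc n + Suc n" for t
      using r that vwalk_nth[of r "with_proj G" t] len by (auto simp: rabbit_trajectory_def)
    have alternate: "r ! t \<in> X \<longleftrightarrow> (r ! 0 \<in> X \<longleftrightarrow> even t)" if "t \<le> Suc n" for t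
      using that
    proof (induction t)
      case (Suc t)
      then show ?case using step[of t] X by (auto simp: bipartition_def)
    qed auto
    show ?thesis
    proof (cases "r ! 0 \<in> X")
      case True
      then obtain t where "t \<le> n" "r ! t \<in> xs ! t"
        using caught[of "(!) r" 0] step by auto
      then show ?thesis using len by (intro exI[of _ t]) (auto simp: nth_append)
    next
      case False
      then have "r ! Suc n \<in> X" using alternate[of "Suc n"] C(1) by auto
      then obtain t where "t \<le> n" "r ! (Suc n + t) \<in> xs ! t"
        using caught[of "(!) r" "Suc n"] step by auto
      then show ?thesis using len by (intro exI[of _ "Suc n + t"]) (auto simp: nth_append)
    qed
  qed
  then have win: "winning_strategy (with_proj G) (xs @ xs)"
    using xs_ok by (auto simp: winning_strategy_def hunter_strategy_def xs_def)
  have "num_hunters (xs @ xs) \<le> 2"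
    using xs_ok by (auto simp: num_hunters_def xs_def intro!: Max.boundedI)
  then show ?thesis
    using win unfolding hunter_number_def
    by (auto intro: order_trans[OF Least_le])
qed

theorem theorem5p11:
  fixes T :: "'a pair_pre_digraph"
  assumes "finite_tree T"
  shows "\<exists>T' :: nat pair_pre_digraph. is_subdivision_of T' T \<and> hunter_number (with_proj T') \<le> 2"
proof -
  interpret T: pair_graph T using assms by (simp add: finite_tree_def)
  obtain a where a: "a \<in> pverts T"
    using assms by (auto simp: finite_tree_def connected_def strongly_connected_def)
  obtain f :: "'a \<Rightarrow> nat" where f: "inj_on f (pverts T)"
    using finite_imp_inj_to_nat_seg[OF T.finite_verts] by auto
  define G where "G = \<lparr>pverts = f ` pverts T, parcs = map_prod f f ` parcs T\<rparr>"
  have "rtree G (f a)"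
    unfolding G_def by (rule rtree_image[OF finite_tree_rtree[OF assms a] f])
  then obtain T' where T': "subdivision_pair G T'" "clearable T' (f a)"
    using rtree_clearable_subdivision[of G "f a" "{}"] by auto
  \<comment> \<open>Arcs are pairs of vertices, so the isomorphism acts on them by \<open>f\<close>
    in both components.\<close>
  define h where "h = \<lparr>iso_verts = f, iso_arcs = map_prod f f, iso_head = snd, iso_tail = fst\<rparr>"
  have "inj_on (map_prod f f) (parcs T)"
    by (rule inj_on_subset[OF map_prod_inj_on[OF f f]]) (auto dest: T.wellformed')
  then have "T.digraph_isomorphism h"
    using f T.wf_digraph by (auto simp: T.digraph_isomorphism_def h_def)
  moreover have "with_proj G = app_iso h (with_proj T)"
    by (simp add: G_def h_def app_iso_def with_proj_def)
  ultimately have "digraph_iso (with_proj T) (with_proj G)"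
    unfolding digraph_iso_def by blast
  then have "is_subdivision_of T' T" using T'(1) unfolding is_subdivision_of_def by blast
  then show ?thesis using clearable_hunter_number[OF T'(2)] by blast
qed

end
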